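(* Let $X$ be a set equipped with a $\sigma$-algebra and a measure $\mu$ on it, let $Y$ be a Hausdorff topological space with a countable base, and let $f:X\to Y$ be measurable with respect to the Borel $\sigma$-algebra of $Y$. Then there exists a measurable set $N_0\subset X$ with $\mu(N_0)=0$ such that $$\bigcap_{\mu(N)=0}\overline{f(X\setminus N)}=\overline{f(X\setminus N_0)},$$ where the intersection is taken over all measurable sets $N\subset X$ of measure zero and the line denotes closure in $Y$.
   Context: Measures take values in $[0,\infty]$; no finiteness, $\sigma$-finiteness or completeness assumption is made. *)

theory Defs
  imports "HOL-Analysis.Analysis"
begin

text \<open>
  The library's \<^term>\<open>borel\<close> is tied to type-class topologies, whose underlying set is a whole type
  and hence nonempty. This is the counterpart for a topology with an explicit carrier; only its
  space and its sigma-algebra matter for measurability of maps into it.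
\<close>

definition borel_of :: "'a topology \<Rightarrow> 'a measure" where
  "borel_of Y = sigma (topspace Y) {U. openin Y U}"

end

theory Submission
  imports Defs
begin

text \<open>
  Let \<open>N\<^sub>0\<close> be the union of the preimages of those members of a countable base whose preimage is
  null. If a point is outside the closure of \<open>f(X - N)\<close> for some null \<open>N\<close>, it has a basic
  neighbourhood whose preimage lies in \<open>N\<close>, hence in \<open>N\<^sub>0\<close>, so it is outside the closure of
  \<open>f(X - N\<^sub>0)\<close> as well.
\<close>

theorem theorem1:
  fixes M :: "'a measure" and Y :: "'b topology" and f :: "'a \<Rightarrow> 'b"
  assumes "Hausdorff_space Y"
    and "second_countable Y"
    and "f \<in> M \<rightarrow>\<^sub>M borel_of Y"
  shows "\<exists>N\<^sub>0 \<in> null_sets M.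
    (\<Inter>N \<in> null_sets M. Y closure_of (f ` (space M - N))) = Y closure_of (f ` (space M - N\<^sub>0))"
proof -
  obtain \<B> where "countable \<B>" and open_\<B>: "\<And>V. V \<in> \<B> \<Longrightarrow> openin Y V"
    and base: "\<And>U y. openin Y U \<Longrightarrow> y \<in> U \<Longrightarrow> \<exists>V\<in>\<B>. y \<in> V \<and> V \<subseteq> U"
    using \<open>second_countable Y\<close> unfolding second_countable_def by meson
  define \<C> where "\<C> = {V \<in> \<B>. f -` V \<inter> space M \<in> null_sets M}"
  define N\<^sub>0 where "N\<^sub>0 = (\<Union>V\<in>\<C>. f -` V \<inter> space M)"
  have "countable \<C>"
    using \<open>countable \<B>\<close> by (simp add: \<C>_def)
  then have null: "N\<^sub>0 \<in> null_sets M"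
    unfolding N\<^sub>0_def by (intro null_sets_UN') (auto simp: \<C>_def)
  \<comment> \<open>\<open>M\<close> need not be complete: a subset of a null set is known to be
    null only once it is measurable.\<close>
  have meas: "f -` V \<inter> space M \<in> sets M" if "V \<in> \<B>" for V
    \<comment> \<open>\<open>sigma\<close> yields the trivial sigma-algebra unless its generators
      lie in the carrier; \<open>openin_subset\<close> ensures this.\<close>
    using open_\<B>[OF that] openin_subset
    by (intro measurable_sets[OF assms(3)]) (auto simp: borel_of_def sets_measure_of_conv)
  have "Y closure_of (f ` (space M - N\<^sub>0)) \<subseteq> Y closure_of (f ` (space M - N))"
    if N: "N \<in> null_sets M" for N
  proof
    fix y assume y: "y \<in> Y closure_of (f ` (space M - N\<^sub>0))"
    show "y \<in> Y closure_of (f ` (space M - N))"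
    proof (rule ccontr)
      assume "y \<notin> Y closure_of (f ` (space M - N))"
      then obtain U where "openin Y U" "y \<in> U" and U: "U \<inter> f ` (space M - N) = {}"
        using y by (auto simp: in_closure_of)
      then obtain V where V: "V \<in> \<B>" "y \<in> V" "V \<subseteq> U"
        using base by meson
      then have "f -` V \<inter> space M \<subseteq> N"
        using U by auto
      then have "V \<in> \<C>"
        using null_sets_subset[OF N meas] V(1) by (simp add: \<C>_def)
      then have "V \<inter> f ` (space M - N\<^sub>0) = {}"
        by (auto simp: N\<^sub>0_def)
      then show False
        using y V(2) open_\<B>[OF V(1)] unfolding in_closure_of by blast
    qed
  qed
  \<comment> \<open>The other inclusion is immediate, as \<open>N\<^sub>0\<close> is itself one of
    the null sets in the intersection.\<close>
  then have "(\<Inter>N \<in> null_sets M. Y closure_of (f ` (space M - N)))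
      = Y closure_of (f ` (space M - N\<^sub>0))"
    using null by blast
  then show ?thesis
    using null by blast
qed

end
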